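(* Let $c\ \mathtt{return}\ x$ be a program that is safe with respect to a variable typing environment $\Gamma$ and a safe operator typing environment $\Delta$ (i.e. $\Gamma,\Delta\vdash c:(t_0,t_{in},t_{out})$ for some tiers), let $\phi$ be an oracle and $t$ a tier. For all stores $\mu_1,\mu_2$ with $\mu_1\approx^{\Gamma}_{t}\mu_2$, if $\mu_1\models c\to\mu_1'$ and $\mu_2\models c\to\mu_2'$ (semantics with respect to $\phi$), then $\mu_1'\approx^{\Gamma}_{t}\mu_2'$.
   Context: Words and programs. Fix a finite alphabet $\Sigma\supseteq\{0,1\}$ and let $\mathbb{W}=\Sigma^*$ ($\epsilon$ the empty word, $|w|$ the length of $w$); $v\unlhd w$ means $w=u.v.u'$ for some words $u,u'$. Fix a set $\mathbb{V}$ of variables and a set of operators, each operator $\mathtt{op}$ having an arity $ar(\mathtt{op})\ge 0$ and a total function $[\![\mathtt{op}]\!]:\mathbb{W}^{ar(\mathtt{op})}\to\mathbb{W}$. With a single oracle symbol $\phi$: expressions $e::=x\mid \mathtt{op}(e_1,\dots,e_{ar(\mathtt{op})})\mid \phi(e_1\upharpoonright e_2)$; commands $c::=\mathtt{skip}\mid x:=e\mid c_1;c_2\mid \mathtt{if}(e)\{c_1\}\,\mathtt{else}\,\{c_0\}\mid \mathtt{while}(e)\{c\}$; programs $p_\phi::=c\ \mathtt{return}\ x$. Semantics. For $w\in\mathbb{W}$, $n\in\mathbb{N}$, $w_{\upharpoonright n}$ is $w$ truncated to its first $\min(n,|w|)$ symbols followed by a word $10^k$ making the length exactly $n+1$; $[\![\upharpoonright]\!](v,w)=v_{\upharpoonright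 |w|}$. An oracle is a total function $\phi:\mathbb{W}\to\mathbb{W}$. A store is a partial map $\mu:\mathbb{V}\to\mathbb{W}$. Given $\phi$, the deterministic big-step semantics is: $\mu\models x\to\mu(x)$; $\mu\models\mathtt{op}(\bar e)\to[\![\mathtt{op}]\!](\bar w)$ if $\mu\models e_i\to w_i$ for all $i$; $\mu\models\phi(e_1\upharpoonright e_2)\to\phi([\![\upharpoonright]\!](v,w))$ if $\mu\models e_1\to v$, $\mu\models e_2\to w$; $\mu\models\mathtt{skip}\to\mu$; $\mu\models x:=e\to\mu[x\leftarrow w]$ if $\mu\models e\to w$; $\mu\models c_1;c_2\to\mu_2$ if $\mu\models c_1\to\mu_1$ and $\mu_1\models c_2\to\mu_2$; $\mu\models\mathtt{if}(e)\{c_1\}\mathtt{else}\{c_0\}\to\mu'$ if $\mu\models e\to b$ with $b\in\{0,1\}$ and $\mu\models c_b\to\mu'$; $\mu\models\mathtt{while}(e)\{c\}\to\mu$ if $\mu\models e\to 0$; $\mu\models\mathtt{while}(e)\{c\}\to\mu'$ if $\mu\models e\to1$ and $\mu\models c;\mathtt{while}(e)\{c\}\to\mu'$. Operators. $\mathtt{op}$ is neutral if $ar(\mathtt{op})=0$, or $[\![\mathtt{op}]\!]$ takes values in $\{0,1\}$, or for all $\bar w$ there is $i$ with $[\![\mathtt{op}]\!](\bar w)\unlhd w_i$. $\mathtt{op}$ is positive if there is a constant $c$ with $|[\![\mathtt{op}]\!](\bar w)|\le\max_i|w_i|+c$ for all $\bar w$. Typing. Tiers are natural numbers $\mathbf 0,\mathbf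 1,\dots$ with the usual order $\preceq$ (strict: $\prec$), $\vee=\max$, $\wedge=\min$. A variable typing environment $\Gamma$ maps finitely many variables to tiers; an operator typing environment $\Delta$ assigns to each operator $\mathtt{op}$ and tier $t$ a set $\Delta(\mathtt{op})(t)$ of types $t_1\to\dots\to t_{ar(\mathtt{op})}\to t'$. Judgments $\Gamma,\Delta\vdash b:(t,t_{in},t_{out})$ are derived by the rules (writing $\vdash$ for $\Gamma,\Delta\vdash$, all tiers arbitrary): (V) $\vdash x:(\Gamma(x),t_{in},t_{out})$; (OP) if $t_1\to\dots\to t_n\to t\in\Delta(\mathtt{op})(t_{in})$ and $\vdash e_i:(t_i,t_{in},t_{out})$ for all $i\le n=ar(\mathtt{op})$ then $\vdash\mathtt{op}(e_1,\dots,e_n):(t,t_{in},t_{out})$; (OR) if $\vdash e_1:(t,t_{in},t_{out})$, $\vdash e_2:(t_{out},t_{in},t_{out})$, $t\prec t_{in}$ and $t\preceq t_{out}$ then $\vdash\phi(e_1\upharpoonright e_2):(t,t_{in},t_{out})$; (SUB) for a command $c$, if $\vdash c:(t,t_{in},t_{out})$ then $\vdash c:(t+1,t_{in},t_{out})$; (SK) $\vdash\mathtt{skip}:(\mathbf0,t_{in},t_{out})$; (A) if $\vdash x:(t_1,t_{in},t_{out})$, $\vdash e:(t_2,t_{in},t_{out})$, $t_1\preceq t_2$ then $\vdash x:=e:(t_1,t_{in},t_{out})$; (S) if $\vdash c_1:\tau$ and $\vdash c_2:\tau$ then $\vdash c_1;c_2:\tau$; (C) if $\vdash e:\tau$, $\vdash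 c_1:\tau$, $\vdash c_0:\tau$ then $\vdash\mathtt{if}(e)\{c_1\}\mathtt{else}\{c_0\}:\tau$; (W) if $\vdash e:(t,t_{in},t_{out})$, $\vdash c:(t,t,t_{out})$ and $\mathbf1\preceq t\preceq t_{out}$ then $\vdash\mathtt{while}(e)\{c\}:(t,t_{in},t_{out})$; (W$_0$) if $\vdash e:(t,t_{in},t)$, $\vdash c:(t,t,t)$ and $\mathbf1\preceq t$ then $\vdash\mathtt{while}(e)\{c\}:(t,t_{in},\mathbf0)$. Safety. $\Delta$ is safe if for each operator $\mathtt{op}$ it types with $ar(\mathtt{op})>0$: $\mathtt{op}$ is neutral or positive, $[\![\mathtt{op}]\!]$ is polynomial-time computable, and for every tier $t_{in}$ and every $t_1\to\dots\to t_n\to t\in\Delta(\mathtt{op})(t_{in})$: $t\preceq\wedge_i t_i\preceq\vee_i t_i\preceq t_{in}$, and $t\prec t_{in}$ if $\mathtt{op}$ is positive but not neutral. Store equivalence: $\mu\approx^\Gamma_t\mu'$ iff $dom(\mu)=dom(\mu')=dom(\Gamma)$ and $\mu(x)=\mu'(x)$ for every $x\in dom(\Gamma)$ with $t\preceq\Gamma(x)$. *)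

theory Defs
  imports Main "HOL-Library.Sublist" "HOL-Computational_Algebra.Polynomial"
begin

text \<open>The alphabet is a type \<open>'s\<close> of sort \<open>{finite, zero_neq_one}\<close>: finite, with two distinct
  letters \<open>0\<close> and \<open>1\<close>. The words \<open>0\<close> and \<open>1\<close> are thus \<open>[0]\<close> and \<open>[1]\<close>. Variables and operators are
  the elements of arbitrary types \<open>'v\<close> and \<open>'o\<close>.\<close>

type_synonym 's word = "'s list"
type_synonym ('v, 's) store = "'v \<Rightarrow> 's word option"
type_synonym 's orac = "'s word \<Rightarrow> 's word"
type_synonym tier = nat


section \<open>Syntax\<close>

text \<open>The argument list of \<open>Op\<close> has length \<open>ar op\<close> in every expression of the language. This is
  enforced by the typing rule for operators.\<close>

datatype ('v, 'o) expr =
    Var 'v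
  | Op 'o "('v, 'o) expr list"
  | Orc "('v, 'o) expr" "('v, 'o) expr"

datatype ('v, 'o) cmd =
    Skip
  | Assign 'v "('v, 'o) expr"
  | Seq "('v, 'o) cmd" "('v, 'o) cmd"
  | Cond "('v, 'o) expr" "('v, 'o) cmd" "('v, 'o) cmd"
  | While "('v, 'o) expr" "('v, 'o) cmd"

datatype ('v, 'o) prog = Return "('v, 'o) cmd" 'v


section \<open>Semantics\<close>

definition trunc :: "'s::{finite, zero_neq_one} word \<Rightarrow> nat \<Rightarrow> 's word" where
  "trunc w n = take n w @ 1 # replicate (n - length w) 0"

lemma length_trunc: "length (trunc w n) = n + 1"
  by (simp add: trunc_def)

text \<open>An operator \<open>op\<close> denotes the restriction of \<open>sem op\<close> to the lists of length \<open>ar op\<close>.\<close>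

inductive eval ::
  "('o \<Rightarrow> 's::{finite, zero_neq_one} word list \<Rightarrow> 's word) \<Rightarrow> 's orac \<Rightarrow> ('v, 's) store
    \<Rightarrow> ('v, 'o) expr \<Rightarrow> 's word \<Rightarrow> bool"
  for sem \<phi> \<mu>
where
  eval_Var: "\<mu> x = Some w \<Longrightarrow> eval sem \<phi> \<mu> (Var x) w"
| eval_Op: "list_all2 (eval sem \<phi> \<mu>) es ws \<Longrightarrow> eval sem \<phi> \<mu> (Op op es) (sem op ws)"
| eval_Orc: "eval sem \<phi> \<mu> e1 v \<Longrightarrow> eval sem \<phi> \<mu> e2 w
    \<Longrightarrow> eval sem \<phi> \<mu> (Orc e1 e2) (\<phi> (trunc v (length w)))"

text \<open>In \<open>Cond e c1 c0\<close> the first branch is taken on \<open>1\<close>, the second on \<open>0\<close>.\<close>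

inductive exec ::
  "('o \<Rightarrow> 's::{finite, zero_neq_one} word list \<Rightarrow> 's word) \<Rightarrow> 's orac
    \<Rightarrow> ('v, 'o) cmd \<Rightarrow> ('v, 's) store \<Rightarrow> ('v, 's) store \<Rightarrow> bool"
  for sem \<phi>
where
  exec_Skip: "exec sem \<phi> Skip \<mu> \<mu>"
| exec_Assign: "eval sem \<phi> \<mu> e w \<Longrightarrow> exec sem \<phi> (Assign x e) \<mu> (\<mu>(x \<mapsto> w))"
| exec_Seq: "exec sem \<phi> c1 \<mu> \<mu>1 \<Longrightarrow> exec sem \<phi> c2 \<mu>1 \<mu>2 \<Longrightarrow> exec sem \<phi> (Seq c1 c2) \<mu> \<mu>2"
| exec_Cond1: "eval sem \<phi> \<mu> e [1] \<Longrightarrow> exec sem \<phi> c1 \<mu> \<mu>' \<Longrightarrow> exec sem \<phi> (Cond e c1 c0) \<mu> \<mu>'"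
| exec_Cond0: "eval sem \<phi> \<mu> e [0] \<Longrightarrow> exec sem \<phi> c0 \<mu> \<mu>' \<Longrightarrow> exec sem \<phi> (Cond e c1 c0) \<mu> \<mu>'"
| exec_While0: "eval sem \<phi> \<mu> e [0] \<Longrightarrow> exec sem \<phi> (While e c) \<mu> \<mu>"
| exec_While1: "eval sem \<phi> \<mu> e [1] \<Longrightarrow> exec sem \<phi> (Seq c (While e c)) \<mu> \<mu>'
    \<Longrightarrow> exec sem \<phi> (While e c) \<mu> \<mu>'"


section \<open>Polynomial-time computability\<close>

text \<open>Deterministic one-tape Turing machines with a two-way infinite tape, given by their
  instruction table: a partial function with finite domain, so that only finitely many of the
  states (natural numbers, \<open>0\<close> being initial) and of the auxiliary symbols \<open>Aux j\<close> occur. A machine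
  halts when no instruction applies.\<close>

datatype 's tsym = Blank | Sep | Sym 's | Aux nat

datatype move = MLeft | MStay | MRight

type_synonym 's tm = "nat \<times> 's tsym \<Rightarrow> (nat \<times> 's tsym \<times> move) option"
type_synonym 's config = "nat \<times> int \<times> (int \<Rightarrow> 's tsym)"

fun shift :: "move \<Rightarrow> int" where
  "shift MLeft = -1"
| "shift MStay = 0"
| "shift MRight = 1"

fun tm_step :: "'s tm \<Rightarrow> 's config \<Rightarrow> 's config" where
  "tm_step M (q, i, T) =
    (case M (q, T i) of
       None \<Rightarrow> (q, i, T)
     | Some (q', a, m) \<Rightarrow> (q', i + shift m, T(i := a)))"

fun halted :: "'s tm \<Rightarrow> 's config \<Rightarrow> bool" where
  "halted M (q, i, T) \<longleftrightarrow> M (q, T i) = None"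

definition tape_of :: "'s tsym list \<Rightarrow> int \<Rightarrow> 's tsym" where
  "tape_of s i = (if 0 \<le> i \<and> nat i < length s then s ! nat i else Blank)"

definition encode_args :: "'s word list \<Rightarrow> 's tsym list" where
  "encode_args ws = concat (map (\<lambda>w. map Sym w @ [Sep]) ws)"

definition init_config :: "'s word list \<Rightarrow> 's config" where
  "init_config ws = (0, 0, tape_of (encode_args ws))"

definition tm_computes_within :: "'s tm \<Rightarrow> nat \<Rightarrow> 's word list \<Rightarrow> 's word \<Rightarrow> bool" where
  "tm_computes_within M b ws v \<longleftrightarrow>
     (\<exists>k\<le>b. \<exists>q i. (tm_step M ^^ k) (init_config ws) = (q, i, tape_of (map Sym v))
                \<and> halted M (q, i, tape_of (map Sym v)))"

definition poly_time :: "nat \<Rightarrow> ('s::finite word list \<Rightarrow> 's word) \<Rightarrow> bool" where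
  "poly_time n f \<longleftrightarrow>
     (\<exists>(M :: 's tm) (p :: nat poly). finite (dom M) \<and>
        (\<forall>ws. length ws = n \<longrightarrow>
           tm_computes_within M (poly p (sum_list (map length ws))) ws (f ws)))"


section \<open>Operators\<close>

definition neutral :: "('o \<Rightarrow> nat) \<Rightarrow> ('o \<Rightarrow> 's::{finite, zero_neq_one} word list \<Rightarrow> 's word)
    \<Rightarrow> 'o \<Rightarrow> bool" where
  "neutral ar sem op \<longleftrightarrow>
     ar op = 0
   \<or> (\<forall>ws. length ws = ar op \<longrightarrow> sem op ws \<in> {[0], [1]})
   \<or> (\<forall>ws. length ws = ar op \<longrightarrow> (\<exists>i<ar op. sublist (sem op ws) (ws ! i)))"

text \<open>The inserted \<open>0\<close> only fixes the maximum over the empty list when \<open>ar op = 0\<close>.\<close>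

definition positive :: "('o \<Rightarrow> nat) \<Rightarrow> ('o \<Rightarrow> 's::{finite, zero_neq_one} word list \<Rightarrow> 's word)
    \<Rightarrow> 'o \<Rightarrow> bool" where
  "positive ar sem op \<longleftrightarrow>
     (\<exists>c. \<forall>ws. length ws = ar op \<longrightarrow>
        length (sem op ws) \<le> Max (insert 0 (length ` set ws)) + c)"


section \<open>Typing\<close>

type_synonym 'v var_env = "'v \<Rightarrow> tier option"

text \<open>The pair \<open>([t\<^sub>1, \<dots>, t\<^sub>n], t)\<close> stands for the operator type \<open>t\<^sub>1 \<rightarrow> \<dots> \<rightarrow> t\<^sub>n \<rightarrow> t\<close>.\<close>

type_synonym 'o op_env = "'o \<Rightarrow> tier \<Rightarrow> (tier list \<times> tier) set"

definition is_var_env :: "'v var_env \<Rightarrow> bool" where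
  "is_var_env \<Gamma> \<longleftrightarrow> finite (dom \<Gamma>)"

definition is_op_env :: "('o \<Rightarrow> nat) \<Rightarrow> 'o op_env \<Rightarrow> bool" where
  "is_op_env ar \<Delta> \<longleftrightarrow> (\<forall>op tin. \<forall>(ts, t) \<in> \<Delta> op tin. length ts = ar op)"

inductive type_expr ::
  "('o \<Rightarrow> nat) \<Rightarrow> 'v var_env \<Rightarrow> 'o op_env \<Rightarrow> ('v, 'o) expr \<Rightarrow> tier \<times> tier \<times> tier \<Rightarrow> bool"
  for ar \<Gamma> \<Delta>
where
  T_V: "\<Gamma> x = Some t \<Longrightarrow> type_expr ar \<Gamma> \<Delta> (Var x) (t, tin, tout)"
| T_OP: "(ts, t) \<in> \<Delta> op tin \<Longrightarrow> length es = ar op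
    \<Longrightarrow> list_all2 (\<lambda>e te. type_expr ar \<Gamma> \<Delta> e (te, tin, tout)) es ts
    \<Longrightarrow> type_expr ar \<Gamma> \<Delta> (Op op es) (t, tin, tout)"
| T_OR: "type_expr ar \<Gamma> \<Delta> e1 (t, tin, tout) \<Longrightarrow> type_expr ar \<Gamma> \<Delta> e2 (tout, tin, tout)
    \<Longrightarrow> t < tin \<Longrightarrow> t \<le> tout \<Longrightarrow> type_expr ar \<Gamma> \<Delta> (Orc e1 e2) (t, tin, tout)"

inductive type_cmd ::
  "('o \<Rightarrow> nat) \<Rightarrow> 'v var_env \<Rightarrow> 'o op_env \<Rightarrow> ('v, 'o) cmd \<Rightarrow> tier \<times> tier \<times> tier \<Rightarrow> bool"
  for ar \<Gamma> \<Delta>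
where
  T_SUB: "type_cmd ar \<Gamma> \<Delta> c (t, tin, tout) \<Longrightarrow> type_cmd ar \<Gamma> \<Delta> c (t + 1, tin, tout)"
| T_SK: "type_cmd ar \<Gamma> \<Delta> Skip (0, tin, tout)"
| T_A: "type_expr ar \<Gamma> \<Delta> (Var x) (t1, tin, tout) \<Longrightarrow> type_expr ar \<Gamma> \<Delta> e (t2, tin, tout)
    \<Longrightarrow> t1 \<le> t2 \<Longrightarrow> type_cmd ar \<Gamma> \<Delta> (Assign x e) (t1, tin, tout)"
| T_S: "type_cmd ar \<Gamma> \<Delta> c1 \<tau> \<Longrightarrow> type_cmd ar \<Gamma> \<Delta> c2 \<tau> \<Longrightarrow> type_cmd ar \<Gamma> \<Delta> (Seq c1 c2) \<tau>"
| T_C: "type_expr ar \<Gamma> \<Delta> e \<tau> \<Longrightarrow> type_cmd ar \<Gamma> \<Delta> c1 \<tau> \<Longrightarrow> type_cmd ar \<Gamma> \<Delta> c0 \<tau>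
    \<Longrightarrow> type_cmd ar \<Gamma> \<Delta> (Cond e c1 c0) \<tau>"
| T_W: "type_expr ar \<Gamma> \<Delta> e (t, tin, tout) \<Longrightarrow> type_cmd ar \<Gamma> \<Delta> c (t, t, tout)
    \<Longrightarrow> 1 \<le> t \<Longrightarrow> t \<le> tout \<Longrightarrow> type_cmd ar \<Gamma> \<Delta> (While e c) (t, tin, tout)"
| T_W0: "type_expr ar \<Gamma> \<Delta> e (t, tin, t) \<Longrightarrow> type_cmd ar \<Gamma> \<Delta> c (t, t, t)
    \<Longrightarrow> 1 \<le> t \<Longrightarrow> type_cmd ar \<Gamma> \<Delta> (While e c) (t, tin, 0)"

definition safe_op_env :: "('o \<Rightarrow> nat) \<Rightarrow> ('o \<Rightarrow> 's::{finite, zero_neq_one} word list \<Rightarrow> 's word)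
    \<Rightarrow> 'o op_env \<Rightarrow> bool" where
  "safe_op_env ar sem \<Delta> \<longleftrightarrow>
     (\<forall>op. ar op > 0 \<and> (\<exists>tin. \<Delta> op tin \<noteq> {}) \<longrightarrow>
        (neutral ar sem op \<or> positive ar sem op)
      \<and> poly_time (ar op) (sem op)
      \<and> (\<forall>tin. \<forall>(ts, t) \<in> \<Delta> op tin.
            t \<le> Min (set ts) \<and> Min (set ts) \<le> Max (set ts) \<and> Max (set ts) \<le> tin
          \<and> (positive ar sem op \<and> \<not> neutral ar sem op \<longrightarrow> t < tin)))"

fun safe_prog :: "('o \<Rightarrow> nat) \<Rightarrow> 'v var_env \<Rightarrow> 'o op_env \<Rightarrow> ('v, 'o) prog \<Rightarrow> bool" where
  "safe_prog ar \<Gamma> \<Delta> (Return c x) \<longleftrightarrow> (\<exists>t0 tin tout. type_cmd ar \<Gamma> \<Delta> c (t0, tin, tout))"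


section \<open>Store equivalence\<close>

definition store_equiv :: "'v var_env \<Rightarrow> tier \<Rightarrow> ('v, 's) store \<Rightarrow> ('v, 's) store \<Rightarrow> bool" where
  "store_equiv \<Gamma> t \<mu> \<mu>' \<longleftrightarrow>
     dom \<mu> = dom \<Gamma> \<and> dom \<mu>' = dom \<Gamma> \<and>
     (\<forall>x \<in> dom \<Gamma>. t \<le> the (\<Gamma> x) \<longrightarrow> \<mu> x = \<mu>' x)"

end

theory Submission
  imports Defs
begin

text \<open>Fix the set \<open>H\<close> of variables of tier at least \<open>t\<close>. Safety of operators makes an expression
  of tier at least \<open>t\<close> read only \<open>H\<close>, and a command of tier below \<open>t\<close> writes no variable of \<open>H\<close>.
  So a variable of \<open>H\<close> is only assigned from \<open>H\<close>, and each guard either depends only on \<open>H\<close>, so that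
  two runs from stores agreeing on \<open>H\<close> take the same branch, or governs commands that leave \<open>H\<close>
  unchanged.\<close>

abbreviation vars :: "('v, 'o) expr \<Rightarrow> 'v set" where
  "vars \<equiv> set1_expr"

fun assigned :: "('v, 'o) cmd \<Rightarrow> 'v set" where
  "assigned Skip = {}"
| "assigned (Assign x e) = {x}"
| "assigned (Seq c1 c2) = assigned c1 \<union> assigned c2"
| "assigned (Cond e c1 c0) = assigned c1 \<union> assigned c0"
| "assigned (While e c) = assigned c"

text \<open>Typability is not used as the invariant of the induction on executions, since it is not
  preserved by unfolding a loop: in \<open>While e c\<close> the innermost tier changes from \<open>tin\<close> to \<open>t\<close> for
  the body \<open>c\<close>, while \<open>Seq c (While e c)\<close> needs a common one. The following condition is.\<close>

fun flow_secure :: "'v set \<Rightarrow> ('v, 'o) cmd \<Rightarrow> bool" where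
  "flow_secure H Skip \<longleftrightarrow> True"
| "flow_secure H (Assign x e) \<longleftrightarrow> (x \<in> H \<longrightarrow> vars e \<subseteq> H)"
| "flow_secure H (Seq c1 c2) \<longleftrightarrow> flow_secure H c1 \<and> flow_secure H c2"
| "flow_secure H (Cond e c1 c0) \<longleftrightarrow> flow_secure H c1 \<and> flow_secure H c0 \<and>
     (vars e \<subseteq> H \<or> assigned (Cond e c1 c0) \<inter> H = {})"
| "flow_secure H (While e c) \<longleftrightarrow> flow_secure H c \<and>
     (vars e \<subseteq> H \<or> assigned (While e c) \<inter> H = {})"

text \<open>With equal stores this is determinism. For stores that differ outside
  \<open>vars e\<close> it carries the value of a guard or an assigned expression from one run to
  the other.\<close>

lemma eval_agree:
  assumes "eval sem \<phi> \<mu> e w" and "eval sem \<phi> \<mu>' e w'" and "\<forall>x\<in>vars e. \<mu> x = \<mu>' x"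
  shows "w = w'"
  using assms
proof (induction arbitrary: w' rule: eval.induct)
  case (eval_Var x w)
  then show ?case by (auto elim: eval.cases)
next
  case (eval_Op es ws op)
  from eval_Op.prems(1) obtain ws'
    where ws': "list_all2 (eval sem \<phi> \<mu>') es ws'" "w' = sem op ws'"
    by (auto elim: eval.cases)
  have "ws ! i = ws' ! i" if "i < length es" for i
    using eval_Op.IH ws'(1) eval_Op.prems(2) that
    by (force simp: list_all2_conv_all_nth)
  then have "ws = ws'"
    using eval_Op.IH ws'(1) by (auto simp: list_all2_conv_all_nth intro: nth_equalityI)
  then show ?case using ws'(2) by simp
next
  case (eval_Orc e1 v e2 w)
  from eval_Orc.prems(1) obtain v' u'
    where "eval sem \<phi> \<mu>' e1 v'" "eval sem \<phi> \<mu>' e2 u'" "w' = \<phi> (trunc v' (length u'))"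
    by (auto elim: eval.cases)
  with eval_Orc show ?case by (metis Un_iff expr.set(3))
qed

inductive_cases exec_SkipE: "exec sem \<phi> Skip \<mu> \<mu>'"
inductive_cases exec_AssignE: "exec sem \<phi> (Assign x e) \<mu> \<mu>'"
inductive_cases exec_SeqE: "exec sem \<phi> (Seq c1 c2) \<mu> \<mu>'"
inductive_cases exec_CondE: "exec sem \<phi> (Cond e c1 c0) \<mu> \<mu>'"
inductive_cases exec_WhileE: "exec sem \<phi> (While e c) \<mu> \<mu>'"

lemma exec_unassigned:
  assumes "exec sem \<phi> c \<mu> \<mu>'" and "x \<notin> assigned c"
  shows "\<mu>' x = \<mu> x"
  using assms by (induction rule: exec.induct) auto

text \<open>Store equivalence also fixes domains; overwriting a variable that already has a value
  does not enlarge the domain.\<close>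

lemma exec_dom:
  assumes "exec sem \<phi> c \<mu> \<mu>'" and "assigned c \<subseteq> dom \<mu>"
  shows "dom \<mu>' = dom \<mu>"
  using assms by (induction rule: exec.induct) auto

text \<open>Meant for guards that read outside \<open>H\<close>: the runs may then take different
  branches or iterate a different number of times, so each is compared with its own initial store
  instead of with the other run.\<close>

lemma exec_agree_if_unassigned:
  assumes "exec sem \<phi> c \<mu> \<mu>'" and "exec sem \<phi> c \<nu> \<nu>'" and "assigned c \<inter> H = {}"
    and "\<forall>x\<in>H. \<mu> x = \<nu> x"
  shows "\<forall>x\<in>H. \<mu>' x = \<nu>' x"
  using exec_unassigned[OF assms(1)] exec_unassigned[OF assms(2)] assms(3,4)
  by (metis disjoint_iff)

text \<open>Induction on the first execution, rather than on \<open>c\<close>, supplies a hypothesis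
  for the unfolded loop; the second run stays arbitrary.\<close>

lemma flow_secure_noninterference:
  assumes "exec sem \<phi> c \<mu> \<mu>'" and "exec sem \<phi> c \<nu> \<nu>'" and "flow_secure H c"
    and "\<forall>x\<in>H. \<mu> x = \<nu> x"
  shows "\<forall>x\<in>H. \<mu>' x = \<nu>' x"
  using assms
proof (induction arbitrary: \<nu> \<nu>' rule: exec.induct)
  case (exec_Skip \<mu>)
  then show ?case by (auto elim: exec_SkipE)
next
  case (exec_Assign \<mu> e w x)
  from exec_Assign.prems(1) obtain w' where w': "eval sem \<phi> \<nu> e w'" "\<nu>' = \<nu>(x \<mapsto> w')"
    by (auto elim: exec_AssignE)
  have "w = w'" if "x \<in> H"
    using eval_agree[OF exec_Assign.hyps w'(1)] exec_Assign.prems(2,3) that by auto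
  then show ?case using w'(2) exec_Assign.prems(3) by auto
next
  case (exec_Seq c1 \<mu> \<mu>1 c2 \<mu>2)
  from exec_Seq.prems(1) obtain \<nu>1 where "exec sem \<phi> c1 \<nu> \<nu>1" "exec sem \<phi> c2 \<nu>1 \<nu>'"
    by (auto elim: exec_SeqE)
  with exec_Seq.IH exec_Seq.prems(2,3) show ?case by (metis flow_secure.simps(3))
next
  case (exec_Cond1 \<mu> e c1 \<mu>' c0)
  show ?case
  proof (cases "vars e \<subseteq> H")
    case True
    \<comment> \<open>The guard is \<open>[1]\<close> in \<open>\<mu>\<close> and the stores agree
      on \<open>vars e\<close>, so the value \<open>[0]\<close> in \<open>\<nu>\<close> would force
      \<open>0 = 1\<close>.\<close>
    then have "\<not> eval sem \<phi> \<nu> e [0]"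
      using eval_agree[OF exec_Cond1.hyps(1)] exec_Cond1.prems(3)
      by (metis list.inject subsetD zero_neq_one)
    with exec_Cond1.prems(1) have "exec sem \<phi> c1 \<nu> \<nu>'" by (auto elim: exec_CondE)
    with exec_Cond1.IH exec_Cond1.prems show ?thesis by simp
  next
    case False
    with exec_agree_if_unassigned[OF exec.exec_Cond1[OF exec_Cond1.hyps] exec_Cond1.prems(1)]
      exec_Cond1.prems show ?thesis by auto
  qed
next
  case (exec_Cond0 \<mu> e c0 \<mu>' c1)
  show ?case
  proof (cases "vars e \<subseteq> H")
    case True
    then have "\<not> eval sem \<phi> \<nu> e [1]"
      using eval_agree[OF exec_Cond0.hyps(1)] exec_Cond0.prems(3)
      by (metis list.inject subsetD zero_neq_one)
    with exec_Cond0.prems(1) have "exec sem \<phi> c0 \<nu> \<nu>'" by (auto elim: exec_CondE)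
    with exec_Cond0.IH exec_Cond0.prems show ?thesis by simp
  next
    case False
    with exec_agree_if_unassigned[OF exec.exec_Cond0[OF exec_Cond0.hyps] exec_Cond0.prems(1)]
      exec_Cond0.prems show ?thesis by auto
  qed
next
  case (exec_While0 \<mu> e c)
  show ?case
  proof (cases "vars e \<subseteq> H")
    case True
    then have "\<not> eval sem \<phi> \<nu> e [1]"
      using eval_agree[OF exec_While0.hyps(1)] exec_While0.prems(3)
      by (metis list.inject subsetD zero_neq_one)
    with exec_While0.prems(1) have "\<nu>' = \<nu>" by (auto elim: exec_WhileE)
    with exec_While0.prems show ?thesis by simp
  next
    case False
    with exec_agree_if_unassigned[OF exec.exec_While0[OF exec_While0.hyps] exec_While0.prems(1)]
      exec_While0.prems show ?thesis by auto
  qed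
next
  case (exec_While1 \<mu> e c \<mu>')
  show ?case
  proof (cases "vars e \<subseteq> H")
    case True
    then have "\<not> eval sem \<phi> \<nu> e [0]"
      using eval_agree[OF exec_While1.hyps(1)] exec_While1.prems(3)
      by (metis list.inject subsetD zero_neq_one)
    with exec_While1.prems(1) have "exec sem \<phi> (Seq c (While e c)) \<nu> \<nu>'" by (auto elim: exec_WhileE)
    \<comment> \<open>\<open>flow_secure\<close> passes from the loop to its unfolding
      \<open>Seq c (While e c)\<close>, which the induction hypothesis concerns.\<close>
    with exec_While1.IH exec_While1.prems show ?thesis by simp
  next
    case False
    with exec_agree_if_unassigned[OF exec.exec_While1[OF exec_While1.hyps] exec_While1.prems(1)]
      exec_While1.prems show ?thesis by auto
  qed
qed

text \<open>Safety bounds \<open>t\<close> by the least argument tier for operators of positive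
  arity; the arity is positive here because \<open>ts\<close> has that length and contains
  \<open>t'\<close>.\<close>

lemma op_type_le:
  assumes "is_op_env ar \<Delta>" and "safe_op_env ar sem \<Delta>" and "(ts, t) \<in> \<Delta> op tin" and "t' \<in> set ts"
  shows "t \<le> t'"
proof -
  have "length ts = ar op"
    using assms(1,3) unfolding is_op_env_def by blast
  then have "ar op > 0"
    using length_pos_if_in_set[OF assms(4)] by simp
  then have "t \<le> Min (set ts)"
    using assms(2,3) unfolding safe_op_env_def by blast
  also have "\<dots> \<le> t'"
    using assms(4) by simp
  finally show ?thesis .
qed

text \<open>Tiers never rise from arguments to result: at operators by \<open>op_type_le\<close>, at
  oracle calls because the second argument has tier \<open>tout\<close> and
  \<open>t \<le> tout\<close>.\<close>

lemma type_expr_vars: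
  assumes "is_op_env ar \<Delta>" and "safe_op_env ar sem \<Delta>"
    and "type_expr ar \<Gamma> \<Delta> e (t, tin, tout)" and "x \<in> vars e"
  shows "\<exists>s\<ge>t. \<Gamma> x = Some s"
  using assms(3,4)
proof (induction e "(t, tin, tout)" arbitrary: t rule: type_expr.induct)
  case (T_V y t)
  then show ?case by auto
next
  case (T_OP ts t op es)
  from T_OP.prems obtain e where e: "e \<in> set es" "x \<in> vars e" by auto
  then obtain te where te: "te \<in> set ts" "\<exists>s\<ge>te. \<Gamma> x = Some s"
    using T_OP.hyps(3) by (fastforce simp: list_all2_conv_all_nth in_set_conv_nth)
  with op_type_le[OF assms(1,2) T_OP.hyps(1)] show ?case using le_trans by blast
next
  case (T_OR e1 t e2)
  then show ?case using le_trans by fastforce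
qed

text \<open>An assignment starts at the tier of its variable, and \<open>T_SUB\<close> only raises
  command tiers. The existence of a tier also places assigned variables in
  \<open>dom \<Gamma>\<close>.\<close>

lemma type_cmd_assigned:
  assumes "type_cmd ar \<Gamma> \<Delta> c (t, tin, tout)" and "x \<in> assigned c"
  shows "\<exists>s\<le>t. \<Gamma> x = Some s"
  using assms
proof (induction c "(t, tin, tout)" arbitrary: t tin tout rule: type_cmd.induct)
  case (T_SUB c t tin tout)
  then show ?case using le_SucI by fastforce
next
  case (T_A y t1 tin tout e t2)
  then show ?case by (auto elim: type_expr.cases)
qed auto

text \<open>A guard and the commands it governs share a tier \<open>t\<close>, which is compared
  with \<open>l\<close>: the case \<open>l \<le> t\<close> confines the reads of the guard, the
  other case the writes of the commands.\<close>

lemma type_cmd_flow_secure: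
  assumes "is_op_env ar \<Delta>" and "safe_op_env ar sem \<Delta>"
    and "type_cmd ar \<Gamma> \<Delta> c (t, tin, tout)"
  shows "flow_secure {x \<in> dom \<Gamma>. l \<le> the (\<Gamma> x)} c"
proof -
  let ?H = "{x \<in> dom \<Gamma>. l \<le> the (\<Gamma> x)}"
  have reads: "vars e \<subseteq> ?H" if "type_expr ar \<Gamma> \<Delta> e (t, tin, tout)" "l \<le> t" for e t tin tout
    using type_expr_vars[OF assms(1,2) that(1)] that(2) by fastforce
  have writes: "assigned c \<inter> ?H = {}" if "type_cmd ar \<Gamma> \<Delta> c (t, tin, tout)" "\<not> l \<le> t"
    for c and t tin tout
    using type_cmd_assigned[OF that(1)] that(2) by fastforce
  show ?thesis
    using assms(3)
  proof (induction c "(t, tin, tout)" arbitrary: t tin tout rule: type_cmd.induct)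
    case (T_A x t1 tin tout e t2)
    then have "\<Gamma> x = Some t1" by (auto elim: type_expr.cases)
    \<comment> \<open>If \<open>x\<close> lies in \<open>?H\<close>, then
      \<open>l \<le> t1 \<le> t2\<close>, so \<open>reads\<close> applies to
      \<open>e\<close>.\<close>
    then show ?case using reads[OF T_A.hyps(2)] T_A.hyps(3) by auto
  next
    case (T_C e t tin tout c1 c0)
    then show ?case using reads[OF T_C.hyps(1)]
        writes[OF type_cmd.T_C[OF T_C.hyps(1,2,4)]] by auto
  next
    case (T_W e t tin tout c)
    then show ?case using reads[OF T_W.hyps(1)] writes[OF T_W.hyps(2)] by auto
  next
    case (T_W0 e t tin c)
    then show ?case using reads[OF T_W0.hyps(1)] writes[OF T_W0.hyps(2)] by auto
  qed auto
qed

theorem theorem6p5: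
  fixes ar :: "'o \<Rightarrow> nat"
    and sem :: "'o \<Rightarrow> 's::{finite, zero_neq_one} word list \<Rightarrow> 's word"
    and \<phi> :: "'s orac"
    and \<Gamma> :: "'v var_env"
    and \<Delta> :: "'o op_env"
    and c :: "('v, 'o) cmd"
    and x :: 'v
    and t :: tier
    and \<mu>\<^sub>1 \<mu>\<^sub>2 \<mu>\<^sub>1' \<mu>\<^sub>2' :: "('v, 's) store"
  assumes "is_var_env \<Gamma>"
    and "is_op_env ar \<Delta>"
    and "safe_op_env ar sem \<Delta>"
    and "safe_prog ar \<Gamma> \<Delta> (Return c x)"
    and "store_equiv \<Gamma> t \<mu>\<^sub>1 \<mu>\<^sub>2"
    and "exec sem \<phi> c \<mu>\<^sub>1 \<mu>\<^sub>1'"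
    and "exec sem \<phi> c \<mu>\<^sub>2 \<mu>\<^sub>2'"
  shows "store_equiv \<Gamma> t \<mu>\<^sub>1' \<mu>\<^sub>2'"
proof -
  obtain t0 tin tout where typed: "type_cmd ar \<Gamma> \<Delta> c (t0, tin, tout)"
    using assms(4) by auto
  have dom: "dom \<mu>\<^sub>1 = dom \<Gamma>" "dom \<mu>\<^sub>2 = dom \<Gamma>"
    using assms(5) by (simp_all add: store_equiv_def)
  have "assigned c \<subseteq> dom \<Gamma>"
    using type_cmd_assigned[OF typed] by blast
  then have "dom \<mu>\<^sub>1' = dom \<Gamma>" "dom \<mu>\<^sub>2' = dom \<Gamma>"
    using exec_dom[OF assms(6)] exec_dom[OF assms(7)] dom by simp_all
  moreover have "\<forall>x\<in>{x \<in> dom \<Gamma>. t \<le> the (\<Gamma> x)}. \<mu>\<^sub>1' x = \<mu>\<^sub>2' x"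
    using flow_secure_noninterference[OF assms(6,7) type_cmd_flow_secure[OF assms(2,3) typed]]
      assms(5) unfolding store_equiv_def by blast
  ultimately show ?thesis
    by (simp add: store_equiv_def)
qed

end
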